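(* Let $0\le a<b$ and let $f:[a,b]\to\mathbb{R}$ be differentiable on $(a,b)$ such that $f'\in L_1[a,b]$. Let $0\le\lambda\le1$. If $|f'(x)|\le M$ for every $x\in[a,b]$ and $\alpha\ge1$, then, for $x\in[a,b]$, the following inequality holds: $$\left|(1-2\lambda)f(x)-\frac{\Gamma(\alpha)}{b-a}(b-x)^{1-\alpha}J_a^{\alpha}f(b)+\lambda\left(\frac{b-a}{b-x}\right)^{\alpha-1}f(a)+J_a^{\alpha-1}\big(P_3(x,b)f(b)\big)\right|$$ $$\le\frac{M}{\alpha(\alpha+1)}\left\{(b-a)^{\alpha}(b-x)^{1-\alpha}\left[2\lambda^{\alpha+1}+2(1-\lambda)^{\alpha+1}+\lambda(b-a)-1\right]+(b-x)\left[2\alpha\frac{b-x}{b-a}-(\alpha+1)\right]\right\},$$ where $$P_3(x,t)=\begin{cases}\dfrac{t-(1-\lambda)a-\lambda b}{b-a}(b-x)^{1-\alpha}\,\Gamma(\alpha), & a\le t<x,\\[2mm] \dfrac{t-(1-\lambda)b-\lambda a}{b-a}(b-x)^{1-\alpha}\,\Gamma(\alpha), & x\le t\le b.\end{cases}$$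
   Context: For $\beta\ge 0$ and $a\ge0$ the Riemann-Liouville fractional integral is $J_a^{\beta}g(y)=\frac{1}{\Gamma(\beta)}\int_a^y (y-t)^{\beta-1}g(t)\,dt$ if $\beta>0$, and $J_a^0g(y)=g(y)$. The notation $J_a^{\beta}(P_3(x,b)g(b))$ means $J_a^\beta$ applied to the function $t\mapsto P_3(x,t)g(t)$ and evaluated at $b$ (with $x$ fixed): for $\beta>0$ it equals $\frac{1}{\Gamma(\beta)}\int_a^b (b-t)^{\beta-1}P_3(x,t)g(t)\,dt$, and for $\beta=0$ it equals $P_3(x,b)g(b)$.
   Formalization: The bracket term λ(b-a)-1 is corrected to λ(α+1)-1; as printed the bound fails (f=0, M=1, α=1, λ=1/2, a=0, b=1/2, x=1/4 gives -1/16). x=b is excluded for α>1, where (b-x)^{1-α} is undefined, and f is taken continuous on [a,b], as bounded f' at the endpoints implies. *)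

theory Defs
  imports "HOL-Analysis.Analysis"
begin

text \<open>
  Real power with the convention that exponent 0 always gives 1; the library has
  \<^term>\<open>(0::real) powr 0 = 0\<close>. The difference matters only for \<open>(b - x)\<^sup>1\<^sup>-\<^sup>\<alpha>\<close> and
  \<open>((b - a) / (b - x))\<^sup>\<alpha>\<^sup>-\<^sup>1\<close> at \<open>x = b\<close>, \<open>\<alpha> = 1\<close>, where both factors are meant to be 1.
\<close>

definition rpow :: "real \<Rightarrow> real \<Rightarrow> real" where
  "rpow x p = (if p = 0 then 1 else x powr p)"

text \<open>
  Riemann--Liouville fractional integral of order \<open>\<beta> \<ge> 0\<close> based at \<open>a\<close>, evaluated at
  \<open>y \<ge> a\<close> only. The integral is the Lebesgue integral.
\<close>

definition RL_integral :: "real \<Rightarrow> real \<Rightarrow> (real \<Rightarrow> real) \<Rightarrow> real \<Rightarrow> real" where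
  "RL_integral a \<beta> g y =
     (if \<beta> = 0 then g y
      else 1 / Gamma \<beta> *
        set_lebesgue_integral lebesgue {a..y} (\<lambda>t. (y - t) powr (\<beta> - 1) * g t))"

definition P3 :: "real \<Rightarrow> real \<Rightarrow> real \<Rightarrow> real \<Rightarrow> real \<Rightarrow> real \<Rightarrow> real" where
  "P3 a b lam \<alpha> x t =
     (if t < x
      then (t - (1 - lam) * a - lam * b) / (b - a) * rpow (b - x) (1 - \<alpha>) * Gamma \<alpha>
      else (t - (1 - lam) * b - lam * a) / (b - a) * rpow (b - x) (1 - \<alpha>) * Gamma \<alpha>)"

text \<open>
  The bound in the theorem comes from \<open>\<bar>J\<^sub>a\<^sup>\<alpha> (P3 f') (b)\<bar> \<le> M J\<^sub>a\<^sup>\<alpha> \<bar>P3\<bar> (b)\<close>. With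
  \<open>L = b - a\<close>, \<open>h = b - x\<close>, \<open>s = b - t\<close> one has to estimate
  \<open>(\<integral>\<^sub>0\<^sup>h s\<^sup>\<alpha>\<^sup>-\<^sup>1 \<bar>lam L - s\<bar> ds + \<integral>\<^sub>h\<^sup>L s\<^sup>\<alpha>\<^sup>-\<^sup>1 \<bar>(1 - lam) L - s\<bar> ds) h\<^sup>1\<^sup>-\<^sup>\<alpha> / L\<close>,
  and the coefficient of \<open>L\<^sup>\<alpha> h\<^sup>1\<^sup>-\<^sup>\<alpha> / (\<alpha> (\<alpha> + 1))\<close> is
  \<open>2 lam\<^sup>\<alpha>\<^sup>+\<^sup>1 + 2 (1 - lam)\<^sup>\<alpha>\<^sup>+\<^sup>1 + \<alpha> - (\<alpha> + 1) (1 - lam)\<close>, whose last two terms are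
  \<open>lam (\<alpha> + 1) - 1\<close>. The source prints \<open>lam (b - a) - 1\<close> here, a misprint: for
  \<open>f = 0\<close>, \<open>M = 1\<close>, \<open>\<alpha> = 1\<close>, \<open>lam = 1/2\<close>, \<open>a = 0\<close>, \<open>b = 1/2\<close>, \<open>x = 1/4\<close> the printed bound
  is \<open>-1/16\<close>.
\<close>

end

theory Submission
  imports Defs
begin

text \<open>
  Write \<open>w t = (b - t)\<^sup>\<alpha>\<^sup>-\<^sup>1\<close>, and let \<open>q\<close> be the kernel equal to \<open>t - c\<close> for \<open>t < x\<close> and to
  \<open>t - d\<close> for \<open>t \<ge> x\<close>, with nodes \<open>c = (1 - lam) a + lam b\<close> and \<open>d = (1 - lam) b + lam a\<close>. Up to
  the factor \<open>(b - x)\<^sup>1\<^sup>-\<^sup>\<alpha> / (b - a)\<close>, the quantity inside the absolute value is the single integral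
  \<open>\<integral> w q f'\<close> over \<open>[a, b]\<close>. Indeed, integrating \<open>(w q f)'\<close> over \<open>[a, x]\<close> and over
  \<open>[x, b]\<close> gives the boundary terms at \<open>a\<close>, \<open>x\<close> and \<open>b\<close>. The term of \<open>(w q f)'\<close> in
  which \<open>q\<close> is differentiated gives \<open>\<Gamma>(\<alpha>) J\<^sup>\<alpha> f\<close>, and the one in which \<open>w\<close> is
  differentiated gives the integral of order \<open>\<alpha> - 1\<close> of \<open>P\<^sub>3 f\<close>; this is
  \<open>weighted_montgomery_identity\<close>. For \<open>\<alpha> = 1\<close> the coefficient \<open>\<alpha> - 1\<close> of the last
  integral vanishes, and the boundary term at \<open>b\<close>, which is zero for \<open>\<alpha> > 1\<close>, takes its place.

  Since \<open>\<bar>f'\<bar> \<le> M\<close>, what remains is to bound \<open>\<integral> w \<bar>q\<bar>\<close>. A primitive \<open>\<Phi>\<close> of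
  \<open>w t (t - c)\<close> has its minimum at \<open>t = c\<close>, so that the integral of \<open>w t \<bar>t - c\<bar>\<close> over
  \<open>[u, v]\<close> is at most \<open>\<Phi> u + \<Phi> v - 2 \<Phi> c\<close>, with equality if \<open>c\<close> lies in \<open>[u, v]\<close>
  (\<open>integral_weighted_abs_le\<close>). This form does not depend on the position of the nodes relative to
  \<open>x\<close>, which is why one closed formula covers all \<open>lam\<close> and \<open>x\<close>; evaluating it in
  \<open>kernel_bound_closed_form\<close> gives the right-hand side.
\<close>

section \<open>The weight and its primitives\<close>

lemma continuous_on_rpow_diff:
  fixes b p :: real
  assumes "0 \<le> p" and "S \<subseteq> {..b}"
  shows "continuous_on S (\<lambda>t. rpow (b - t) p)"
proof (cases "p = 0")
  case True
  then show ?thesis by (simp add: rpow_def)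
next
  case False
  have "continuous_on S (\<lambda>t. (b - t) powr p)"
    using assms False by (intro continuous_on_powr' continuous_intros) auto
  then show ?thesis using False by (simp add: rpow_def)
qed

lemma has_real_derivative_rpow_diff:
  fixes b p t :: real
  assumes "t < b"
  shows "((\<lambda>t. rpow (b - t) p) has_real_derivative - p * (b - t) powr (p - 1)) (at t)"
proof (cases "p = 0")
  case True
  then show ?thesis by (simp add: rpow_def)
next
  case False
  have "((\<lambda>t. (b - t) powr p) has_real_derivative - p * (b - t) powr (p - 1)) (at t)"
    using assms by (auto intro!: derivative_eq_intros simp: powr_diff field_simps)
  then show ?thesis using False by (simp add: rpow_def)
qed

lemma rpow_nonneg: "0 \<le> rpow y p"
  by (simp add: rpow_def)

lemma rpow_mult_self:
  fixes h p :: real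
  assumes "0 \<le> h" and "0 < h \<or> p = 0"
  shows "rpow h (- p) * rpow h p = 1"
  using assms by (auto simp: rpow_def powr_minus)

text \<open>
  The improper case is \<open>p < 1\<close>, where the integrand is unbounded at \<open>b\<close>: its primitive is still
  continuous there, and nonnegativity upgrades integrability to absolute integrability.
\<close>

lemma absolutely_integrable_powr_diff:
  fixes a b p :: real
  assumes "a \<le> b" and "0 < p"
  shows "(\<lambda>t. (b - t) powr (p - 1)) absolutely_integrable_on {a..b}"
proof -
  have "((\<lambda>t. p * (b - t) powr (p - 1)) has_integral - rpow (b - b) p - - rpow (b - a) p) {a..b}"
  proof (rule fundamental_theorem_of_calculus_interior)
    show "continuous_on {a..b} (\<lambda>t. - rpow (b - t) p)"
      using assms by (intro continuous_on_minus continuous_on_rpow_diff) auto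
    show "((\<lambda>t. - rpow (b - t) p) has_vector_derivative p * (b - t) powr (p - 1)) (at t)"
      if "t \<in> {a<..<b}" for t
      using DERIV_minus[OF has_real_derivative_rpow_diff[of t b p]] that
      by (simp add: has_real_derivative_iff_has_vector_derivative)
  qed (use assms in simp)
  then have "(\<lambda>t. p * (b - t) powr (p - 1)) integrable_on {a..b}" by blast
  then have "(\<lambda>t. (b - t) powr (p - 1)) integrable_on {a..b}"
    using assms integrable_on_cmult_iff[of p "\<lambda>t. (b - t) powr (p - 1)" "{a..b}"] by simp
  then show ?thesis
    by (rule nonnegative_absolutely_integrable_1) simp
qed

text \<open>
  In the variable \<open>s = b - t\<close> the integrand \<open>w t (t - c)\<close> is \<open>s\<^sup>\<alpha>\<^sup>-\<^sup>1 ((b - c) - s)\<close>. The primitive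
  is normalised to vanish at \<open>t = b\<close>.
\<close>

definition weighted_primitive :: "real \<Rightarrow> real \<Rightarrow> real \<Rightarrow> real \<Rightarrow> real" where
  "weighted_primitive b \<alpha> c t =
     (b - t) powr (\<alpha> + 1) / (\<alpha> + 1) - (b - c) * (b - t) powr \<alpha> / \<alpha>"

lemma has_integral_weighted_primitive:
  fixes b \<alpha> c u v :: real
  assumes "1 \<le> \<alpha>" and "u \<le> v" and "v \<le> b"
  shows "((\<lambda>t. rpow (b - t) (\<alpha> - 1) * (t - c)) has_integral
           weighted_primitive b \<alpha> c v - weighted_primitive b \<alpha> c u) {u..v}"
proof (rule fundamental_theorem_of_calculus_interior)
  show "continuous_on {u..v} (weighted_primitive b \<alpha> c)"
    unfolding weighted_primitive_def using assms
    by (intro continuous_intros continuous_on_powr') auto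
  show "(weighted_primitive b \<alpha> c has_vector_derivative rpow (b - t) (\<alpha> - 1) * (t - c)) (at t)"
    if "t \<in> {u<..<v}" for t
  proof -
    have pos: "b - t > 0" using that assms by auto
    have "(weighted_primitive b \<alpha> c has_real_derivative
            - ((b - t) powr \<alpha>) + (b - c) * (b - t) powr (\<alpha> - 1)) (at t)"
    proof -
      have powr: "((\<lambda>t. (b - t) powr p) has_real_derivative - p * (b - t) powr (p - 1)) (at t)"
        if "p \<noteq> 0" for p
        using has_real_derivative_rpow_diff[of t b p] pos that by (simp add: rpow_def)
      have "((\<lambda>t. (b - t) powr (\<alpha> + 1) / (\<alpha> + 1) - (b - c) * (b - t) powr \<alpha> / \<alpha>)
          has_real_derivative - (\<alpha> + 1) * (b - t) powr (\<alpha> + 1 - 1) / (\<alpha> + 1)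
            - (b - c) * (- \<alpha> * (b - t) powr (\<alpha> - 1)) / \<alpha>) (at t)"
        using assms(1) by (intro DERIV_diff DERIV_cdivide DERIV_cmult powr) auto
      moreover have "- (\<alpha> + 1) * (b - t) powr (\<alpha> + 1 - 1) / (\<alpha> + 1) = - ((b - t) powr \<alpha>)"
        "(b - c) * (- \<alpha> * (b - t) powr (\<alpha> - 1)) / \<alpha> = - ((b - c) * (b - t) powr (\<alpha> - 1))"
        using assms(1) by (simp_all add: divide_simps) (simp add: algebra_simps)
      ultimately show ?thesis
        unfolding weighted_primitive_def[abs_def] by simp
    qed
    moreover have "(b - t) powr \<alpha> = (b - t) powr (\<alpha> - 1) * (b - t)"
      using pos by (simp add: powr_diff)
    moreover have "rpow (b - t) (\<alpha> - 1) = (b - t) powr (\<alpha> - 1)"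
      using pos by (simp add: rpow_def)
    ultimately show ?thesis
      by (simp add: has_real_derivative_iff_has_vector_derivative algebra_simps)
  qed
qed (use assms in simp)

text \<open>The derivative \<open>w t (t - c)\<close> changes sign from negative to positive at \<open>c\<close>.\<close>

lemma weighted_primitive_min:
  fixes b \<alpha> c t :: real
  assumes "1 \<le> \<alpha>" and "c \<le> b" and "t \<le> b"
  shows "weighted_primitive b \<alpha> c c \<le> weighted_primitive b \<alpha> c t"
proof (cases "c \<le> t")
  case True
  have "0 \<le> weighted_primitive b \<alpha> c t - weighted_primitive b \<alpha> c c"
    using has_integral_weighted_primitive[OF assms(1) True assms(3)]
    by (rule has_integral_nonneg) (simp add: rpow_nonneg)
  then show ?thesis by simp
next
  case False
  then have "t \<le> c" by simp
  from has_integral_neg[OF has_integral_weighted_primitive[OF assms(1) this assms(2), of c]]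
  have "0 \<le> - (weighted_primitive b \<alpha> c c - weighted_primitive b \<alpha> c t)"
    by (rule has_integral_nonneg) (simp add: rpow_nonneg mult_nonneg_nonpos)
  then show ?thesis by simp
qed

text \<open>
  If \<open>c\<close> lies outside the interval, the integral is \<open>\<Phi> v - \<Phi> u\<close> or \<open>\<Phi> u - \<Phi> v\<close>, and the
  minimality of \<open>\<Phi> c\<close> turns this into the symmetric bound.
\<close>

lemma integral_weighted_abs_le:
  fixes b \<alpha> c u v :: real
  assumes "1 \<le> \<alpha>" and "u \<le> v" and "v \<le> b" and "c \<le> b"
  obtains I where "((\<lambda>t. rpow (b - t) (\<alpha> - 1) * \<bar>t - c\<bar>) has_integral I) {u..v}"
    and "I \<le> weighted_primitive b \<alpha> c u + weighted_primitive b \<alpha> c v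
              - 2 * weighted_primitive b \<alpha> c c"
proof -
  let ?\<Phi> = "weighted_primitive b \<alpha> c" and ?k = "\<lambda>t. rpow (b - t) (\<alpha> - 1) * \<bar>t - c\<bar>"
  have right: "(?k has_integral ?\<Phi> s - ?\<Phi> r) {r..s}" if "c \<le> r" "r \<le> s" "s \<le> b" for r s
    by (rule has_integral_eq[OF _ has_integral_weighted_primitive[OF assms(1) that(2,3)]])
      (use that(1) in auto)
  have left: "(?k has_integral ?\<Phi> r - ?\<Phi> s) {r..s}" if "s \<le> c" "r \<le> s" "s \<le> b" for r s
  proof -
    have "((\<lambda>t. - (rpow (b - t) (\<alpha> - 1) * (t - c))) has_integral ?\<Phi> r - ?\<Phi> s) {r..s}"
      using has_integral_neg[OF has_integral_weighted_primitive[OF assms(1) that(2,3), of c]]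
      by simp
    then show ?thesis
      by (rule has_integral_eq[rotated]) (use that(1) in \<open>auto simp: algebra_simps\<close>)
  qed
  have mins: "?\<Phi> c \<le> ?\<Phi> u" "?\<Phi> c \<le> ?\<Phi> v"
    using assms by (auto intro!: weighted_primitive_min)
  consider "c \<le> u" | "v \<le> c" | "u \<le> c" "c \<le> v" by linarith
  then show thesis
  proof cases
    case 1
    show thesis by (rule that[OF right[OF 1 assms(2,3)]]) (use mins in simp)
  next
    case 2
    show thesis by (rule that[OF left[OF 2 assms(2,3)]]) (use mins in simp)
  next
    case 3
    show thesis
      by (rule that[OF has_integral_combine[OF 3 left right]]) (use 3 assms in auto)
  qed
qed

section \<open>Integration by parts with a two-piece kernel\<close>

lemma has_integral_join_at:
  fixes f g :: "real \<Rightarrow> real"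
  assumes "(f has_integral I) {a..x}" and "(g has_integral J) {x..b}" and "a \<le> x" and "x \<le> b"
  shows "((\<lambda>t. if t < x then f t else g t) has_integral I + J) {a..b}"
proof (rule has_integral_combine[OF assms(3,4)])
  show "((\<lambda>t. if t < x then f t else g t) has_integral I) {a..x}"
    by (rule has_integral_spike_finite[OF _ _ assms(1), of "{x}"]) auto
  show "((\<lambda>t. if t < x then f t else g t) has_integral J) {x..b}"
    by (rule has_integral_eq[OF _ assms(2)]) auto
qed

text \<open>
  The three parts of \<open>(w t (t - c) f t)'\<close> stay under one integral. Integrability of the part with
  \<open>f'\<close> is then a consequence of that of the other two, which depend on \<open>f\<close> only.
\<close>

lemma has_integral_weighted_by_parts:
  fixes f f' :: "real \<Rightarrow> real" and b \<alpha> c u v :: real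
  assumes "1 \<le> \<alpha>" and "u \<le> v" and "v \<le> b"
    and cont: "continuous_on {u..v} f"
    and deriv: "\<And>t. t \<in> {u<..<v} \<Longrightarrow> (f has_real_derivative f' t) (at t)"
  shows "((\<lambda>t. rpow (b - t) (\<alpha> - 1) * (t - c) * f' t + rpow (b - t) (\<alpha> - 1) * f t
             - (\<alpha> - 1) * ((b - t) powr (\<alpha> - 2) * (t - c) * f t))
          has_integral rpow (b - v) (\<alpha> - 1) * (v - c) * f v
             - rpow (b - u) (\<alpha> - 1) * (u - c) * f u) {u..v}"
proof (rule fundamental_theorem_of_calculus_interior)
  show "continuous_on {u..v} (\<lambda>t. rpow (b - t) (\<alpha> - 1) * (t - c) * f t)"
    using assms by (intro continuous_intros continuous_on_rpow_diff) auto
  show "((\<lambda>t. rpow (b - t) (\<alpha> - 1) * (t - c) * f t) has_vector_derivative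
          rpow (b - t) (\<alpha> - 1) * (t - c) * f' t + rpow (b - t) (\<alpha> - 1) * f t
             - (\<alpha> - 1) * ((b - t) powr (\<alpha> - 2) * (t - c) * f t)) (at t)"
    if "t \<in> {u<..<v}" for t
  proof -
    have w: "((\<lambda>t. rpow (b - t) (\<alpha> - 1)) has_real_derivative
               - (\<alpha> - 1) * (b - t) powr (\<alpha> - 2)) (at t)"
      using has_real_derivative_rpow_diff[of t b "\<alpha> - 1"] that assms(3) by simp
    have lin: "((\<lambda>t. t - c) has_real_derivative 1) (at t)"
      by (auto intro!: derivative_eq_intros)
    show ?thesis
      unfolding has_real_derivative_iff_has_vector_derivative[symmetric]
      by (rule DERIV_cong[OF DERIV_mult[OF DERIV_mult[OF w lin] deriv[OF that]]])
        (simp add: algebra_simps)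
  qed
qed (use assms in simp)

lemma absolutely_integrable_powr_two_piece:
  fixes f g :: "real \<Rightarrow> real" and a b p x :: real
  assumes "a \<le> b" and "0 < p" and "continuous_on {a..b} f" and "continuous_on {a..b} g"
  shows "(\<lambda>t. (b - t) powr (p - 1) * (if t < x then f t else g t)) absolutely_integrable_on {a..b}"
proof -
  let ?h = "\<lambda>t. if t < x then f t else g t"
  have meas: "k \<in> borel_measurable (lebesgue_on {a..b})" if "continuous_on {a..b} k"
    for k :: "real \<Rightarrow> real"
    using that by (intro continuous_imp_measurable_on_sets_lebesgue) auto
  have "?h \<in> borel_measurable (lebesgue_on {a..b})"
  proof (rule measurable_If)
    have "{t \<in> space (lebesgue_on {a..b}). t < x} = {a..b} \<inter> {..<x}" by auto
    moreover have "{..<x} \<in> sets lebesgue" by simp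
    ultimately show "{t \<in> space (lebesgue_on {a..b}). t < x} \<in> sets (lebesgue_on {a..b})"
      by (simp add: sets_restrict_space)
  qed (use meas assms in blast)+
  moreover have "bounded (?h ` {a..b})"
  proof -
    have "bounded (f ` {a..b} \<union> g ` {a..b})"
      using assms(3,4) by (auto intro!: compact_imp_bounded compact_continuous_image)
    then show ?thesis by (rule bounded_subset) auto
  qed
  ultimately have "(\<lambda>t. ?h t * (b - t) powr (p - 1)) absolutely_integrable_on {a..b}"
    by (intro absolutely_integrable_bounded_measurable_product_real
          absolutely_integrable_powr_diff assms) auto
  then show ?thesis by (simp add: mult.commute)
qed

definition two_piece_kernel :: "real \<Rightarrow> real \<Rightarrow> real \<Rightarrow> real \<Rightarrow> real" where
  "two_piece_kernel c d x t = (if t < x then t - c else t - d)"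

text \<open>
  A weighted form of Montgomery's identity. At \<open>x\<close> the kernel jumps by \<open>c - d\<close>, which is the
  source of the term with \<open>f x\<close>.
\<close>

lemma weighted_montgomery_identity:
  fixes f f' :: "real \<Rightarrow> real" and a b c d \<alpha> x :: real
  assumes "1 \<le> \<alpha>" and x: "a \<le> x" "x \<le> b"
    and cont: "continuous_on {a..b} f"
    and deriv: "\<And>t. t \<in> {a<..<b} \<Longrightarrow> (f has_real_derivative f' t) (at t)"
  shows "((\<lambda>t. rpow (b - t) (\<alpha> - 1) * two_piece_kernel c d x t * f' t) has_integral
          rpow (b - x) (\<alpha> - 1) * (d - c) * f x
          + rpow (b - b) (\<alpha> - 1) * (b - d) * f b - rpow (b - a) (\<alpha> - 1) * (a - c) * f a
          - integral {a..b} (\<lambda>t. rpow (b - t) (\<alpha> - 1) * f t)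
          + (\<alpha> - 1) * integral {a..b} (\<lambda>t. (b - t) powr (\<alpha> - 2) * (two_piece_kernel c d x t * f t))) {a..b}"
proof -
  let ?w = "\<lambda>t. rpow (b - t) (\<alpha> - 1)" and ?q = "two_piece_kernel c d x"
  let ?B = "\<lambda>t. (b - t) powr (\<alpha> - 2) * (?q t * f t)"
  have "continuous_on {a..b} (\<lambda>t. ?w t * f t)"
    using assms by (intro continuous_intros continuous_on_rpow_diff) auto
  then have A: "((\<lambda>t. ?w t * f t) has_integral integral {a..b} (\<lambda>t. ?w t * f t)) {a..b}"
    by (intro integrable_integral integrable_continuous_real)
  \<comment> \<open>For \<open>\<alpha> = 1\<close> the integrand, with its factor \<open>(b - t)\<^sup>-\<^sup>1\<close>, may fail to be integrable, but its coefficient is 0.\<close>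
  have B: "((\<lambda>t. (\<alpha> - 1) * ?B t) has_integral (\<alpha> - 1) * integral {a..b} ?B) {a..b}"
  proof (cases "\<alpha> = 1")
    case False
    have "(\<lambda>t. (b - t) powr (\<alpha> - 1 - 1) * (if t < x then (t - c) * f t else (t - d) * f t))
            absolutely_integrable_on {a..b}"
      using assms False
      by (intro absolutely_integrable_powr_two_piece continuous_intros) auto
    also have "(\<lambda>t. (b - t) powr (\<alpha> - 1 - 1) * (if t < x then (t - c) * f t else (t - d) * f t)) = ?B"
      by (auto simp: two_piece_kernel_def)
    finally show ?thesis
      by (intro has_integral_mult_right integrable_integral set_lebesgue_integral_eq_integral(1))
  qed simp
  have parts: "((\<lambda>t. ?w t * ?q t * f' t + ?w t * f t - (\<alpha> - 1) * ?B t) has_integral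
      (?w x * (x - c) * f x - ?w a * (a - c) * f a) + (?w b * (b - d) * f b - ?w x * (x - d) * f x)) {a..b}"
  proof (rule has_integral_eq[OF _ has_integral_join_at[OF
          has_integral_weighted_by_parts has_integral_weighted_by_parts x]])
    show "continuous_on {a..x} f" "continuous_on {x..b} f"
      using x by (auto intro: continuous_on_subset[OF cont])
    show "(f has_real_derivative f' t) (at t)" if "t \<in> {a<..<x}" for t
      using that x deriv by auto
    show "(f has_real_derivative f' t) (at t)" if "t \<in> {x<..<b}" for t
      using that x deriv by auto
  qed (use assms in \<open>auto simp: two_piece_kernel_def mult.assoc\<close>)
  show ?thesis
    using has_integral_add[OF has_integral_diff[OF parts A] B]
    by (simp add: algebra_simps)
qed

lemma integral_weighted_kernel_le:
  fixes f' :: "real \<Rightarrow> real" and a b c d \<alpha> x M I :: real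
  assumes "1 \<le> \<alpha>" and x: "a \<le> x" "x \<le> b" and "c \<le> b" and "d \<le> b" and "0 \<le> M"
    and bound: "\<And>t. t \<in> {a..b} \<Longrightarrow> \<bar>f' t\<bar> \<le> M"
    and I: "((\<lambda>t. rpow (b - t) (\<alpha> - 1) * two_piece_kernel c d x t * f' t) has_integral I) {a..b}"
  shows "\<bar>I\<bar> \<le> M * ((weighted_primitive b \<alpha> c a + weighted_primitive b \<alpha> c x
                        - 2 * weighted_primitive b \<alpha> c c)
                   + (weighted_primitive b \<alpha> d x + weighted_primitive b \<alpha> d b
                        - 2 * weighted_primitive b \<alpha> d d))"
proof -
  let ?q = "two_piece_kernel c d x" and ?w = "\<lambda>t. rpow (b - t) (\<alpha> - 1)"
  obtain J where J: "((\<lambda>t. ?w t * \<bar>t - c\<bar>) has_integral J) {a..x}"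
    "J \<le> weighted_primitive b \<alpha> c a + weighted_primitive b \<alpha> c x - 2 * weighted_primitive b \<alpha> c c"
    using integral_weighted_abs_le[OF assms(1) x assms(4)] by blast
  obtain K where K: "((\<lambda>t. ?w t * \<bar>t - d\<bar>) has_integral K) {x..b}"
    "K \<le> weighted_primitive b \<alpha> d x + weighted_primitive b \<alpha> d b - 2 * weighted_primitive b \<alpha> d d"
    using integral_weighted_abs_le[OF assms(1) x(2) order_refl assms(5)] by blast
  have "((\<lambda>t. ?w t * \<bar>?q t\<bar>) has_integral J + K) {a..b}"
    by (rule has_integral_eq[OF _ has_integral_join_at[OF J(1) K(1) x]])
      (simp add: two_piece_kernel_def)
  then have "((\<lambda>t. M * (?w t * \<bar>?q t\<bar>)) has_integral M * (J + K)) {a..b}"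
    by (rule has_integral_mult_right)
  then have JK: "(\<lambda>t. M * (?w t * \<bar>?q t\<bar>)) integrable_on {a..b}"
    "integral {a..b} (\<lambda>t. M * (?w t * \<bar>?q t\<bar>)) = M * (J + K)"
    by (blast, rule integral_unique)
  have "norm (integral {a..b} (\<lambda>t. ?w t * ?q t * f' t)) \<le> M * (J + K)"
    unfolding JK(2)[symmetric]
  proof (rule integral_norm_bound_integral)
    show "norm (?w t * ?q t * f' t) \<le> M * (?w t * \<bar>?q t\<bar>)" if "t \<in> {a..b}" for t
      using mult_left_mono[OF bound[OF that], of "?w t * \<bar>?q t\<bar>"]
      by (simp add: abs_mult rpow_nonneg mult.commute)
  qed (use I JK in auto)
  also have "\<dots> \<le> M * ((weighted_primitive b \<alpha> c a + weighted_primitive b \<alpha> c x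
                        - 2 * weighted_primitive b \<alpha> c c)
                   + (weighted_primitive b \<alpha> d x + weighted_primitive b \<alpha> d b
                        - 2 * weighted_primitive b \<alpha> d d))"
    by (intro mult_left_mono add_mono J(2) K(2) assms)
  finally show ?thesis using integral_unique[OF I] by simp
qed

section \<open>Fractional integrals as integrals against the weight\<close>

lemma RL_integral_eq_integral:
  fixes g :: "real \<Rightarrow> real" and a b \<beta> :: real
  assumes "0 < \<beta>" and "(\<lambda>t. (b - t) powr (\<beta> - 1) * g t) absolutely_integrable_on {a..b}"
  shows "RL_integral a \<beta> g b = 1 / Gamma \<beta> * integral {a..b} (\<lambda>t. (b - t) powr (\<beta> - 1) * g t)"
  using assms set_lebesgue_integral_eq_integral(2)[OF assms(2)] by (simp add: RL_integral_def)

lemma RL_integral_eq_integral_rpow: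
  fixes f :: "real \<Rightarrow> real" and a b \<alpha> :: real
  assumes "1 \<le> \<alpha>" and "a \<le> b" and "continuous_on {a..b} f"
  shows "Gamma \<alpha> * RL_integral a \<alpha> f b = integral {a..b} (\<lambda>t. rpow (b - t) (\<alpha> - 1) * f t)"
proof -
  have "(\<lambda>t. (b - t) powr (\<alpha> - 1) * (if t < b then f t else f t)) absolutely_integrable_on {a..b}"
    using assms by (intro absolutely_integrable_powr_two_piece) auto
  moreover have "Gamma \<alpha> \<noteq> 0"
    using assms(1) Gamma_real_pos[of \<alpha>] by linarith
  ultimately have "Gamma \<alpha> * RL_integral a \<alpha> f b = integral {a..b} (\<lambda>t. (b - t) powr (\<alpha> - 1) * f t)"
    using assms(1) RL_integral_eq_integral[where \<beta> = \<alpha> and b = b and g = f and a = a] by simp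
  \<comment> \<open>For \<open>\<alpha> = 1\<close> the two integrands differ at \<open>b\<close>, by the convention for \<open>0\<^sup>0\<close>.\<close>
  also have "\<dots> = integral {a..b} (\<lambda>t. rpow (b - t) (\<alpha> - 1) * f t)"
    by (rule integral_spike[of "{b}"]) (auto simp: rpow_def)
  finally show ?thesis .
qed

lemma P3_eq_two_piece_kernel:
  "P3 a b lam \<alpha> x t = rpow (b - x) (1 - \<alpha>) / (b - a) * Gamma \<alpha> *
     two_piece_kernel ((1 - lam) * a + lam * b) ((1 - lam) * b + lam * a) x t"
  by (simp add: P3_def two_piece_kernel_def algebra_simps)

text \<open>
  The order \<open>\<alpha> - 1\<close> is positive or zero, and the operator is defined by different formulas in the two
  cases. They merge into one because \<open>rpow 0 (\<alpha> - 1)\<close> is 1 for \<open>\<alpha> = 1\<close> and 0 otherwise,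
  while the factor \<open>\<alpha> - 1\<close>, which comes from \<open>\<Gamma>(\<alpha>) = (\<alpha> - 1) \<Gamma>(\<alpha> - 1)\<close>, removes the
  integral for \<open>\<alpha> = 1\<close>.
\<close>

lemma RL_integral_P3:
  fixes f :: "real \<Rightarrow> real" and a b lam \<alpha> x :: real
  defines "q \<equiv> two_piece_kernel ((1 - lam) * a + lam * b) ((1 - lam) * b + lam * a) x"
  assumes "1 \<le> \<alpha>" and "a < b" and "x \<le> b" and cont: "continuous_on {a..b} f"
  shows "RL_integral a (\<alpha> - 1) (\<lambda>t. P3 a b lam \<alpha> x t * f t) b =
     rpow (b - x) (1 - \<alpha>) / (b - a) *
       (rpow (b - b) (\<alpha> - 1) * (lam * (b - a)) * f b
        + (\<alpha> - 1) * integral {a..b} (\<lambda>t. (b - t) powr (\<alpha> - 2) * (q t * f t)))"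
proof (cases "\<alpha> = 1")
  case True
  then show ?thesis
    using assms by (simp add: RL_integral_def P3_def rpow_def field_simps)
next
  case False
  let ?K = "rpow (b - x) (1 - \<alpha>) / (b - a) * Gamma \<alpha>"
  have eq: "(b - t) powr (\<alpha> - 1 - 1) * (P3 a b lam \<alpha> x t * f t) =
      ?K * ((b - t) powr (\<alpha> - 2) * (q t * f t))" for t
    by (simp add: P3_eq_two_piece_kernel q_def)
  have "(\<lambda>t. (b - t) powr (\<alpha> - 1 - 1) *
          (if t < x then ?K * (t - ((1 - lam) * a + lam * b)) * f t
           else ?K * (t - ((1 - lam) * b + lam * a)) * f t)) absolutely_integrable_on {a..b}"
    using assms False
    by (intro absolutely_integrable_powr_two_piece continuous_intros) auto
  also have "(\<lambda>t. (b - t) powr (\<alpha> - 1 - 1) *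
          (if t < x then ?K * (t - ((1 - lam) * a + lam * b)) * f t
           else ?K * (t - ((1 - lam) * b + lam * a)) * f t))
      = (\<lambda>t. (b - t) powr (\<alpha> - 1 - 1) * (P3 a b lam \<alpha> x t * f t))"
    by (auto simp: P3_eq_two_piece_kernel two_piece_kernel_def)
  finally have "RL_integral a (\<alpha> - 1) (\<lambda>t. P3 a b lam \<alpha> x t * f t) b =
      1 / Gamma (\<alpha> - 1) * (?K * integral {a..b} (\<lambda>t. (b - t) powr (\<alpha> - 2) * (q t * f t)))"
    using assms(2) False by (subst RL_integral_eq_integral) (auto simp only: eq integral_mult_right)
  moreover have "Gamma \<alpha> = (\<alpha> - 1) * Gamma (\<alpha> - 1)"
    using Gamma_plus1[of "\<alpha> - 1"] assms False nonpos_Ints_nonpos[of "\<alpha> - 1"] by auto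
  moreover have "Gamma (\<alpha> - 1) > 0"
    using assms False by (intro Gamma_real_pos) auto
  moreover have "rpow (b - b) (\<alpha> - 1) = 0" using False by (simp add: rpow_def)
  ultimately show ?thesis by simp
qed

section \<open>The inequality\<close>

lemma weighted_primitive_at_node:
  assumes "1 \<le> \<alpha>" and "0 \<le> \<mu>" and "0 \<le> L" and "b - c = \<mu> * L"
  shows "weighted_primitive b \<alpha> c c = - (\<mu> powr (\<alpha> + 1) * L powr (\<alpha> + 1)) / (\<alpha> * (\<alpha> + 1))"
proof -
  have "(b - c) * (b - c) powr \<alpha> = (b - c) powr (\<alpha> + 1)"
    using assms powr_add[of "b - c" \<alpha> 1] by (simp add: mult.commute)
  then have "weighted_primitive b \<alpha> c c = - ((b - c) powr (\<alpha> + 1)) / (\<alpha> * (\<alpha> + 1))"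
    using assms(1) unfolding weighted_primitive_def by (simp add: field_simps)
  then show ?thesis using assms by (simp add: powr_mult)
qed

text \<open>
  The values at \<open>x\<close> give the part with \<open>b - x\<close>, the values at the two nodes give the powers of
  \<open>lam\<close> and \<open>1 - lam\<close>, and the value at \<open>a\<close> gives \<open>lam (\<alpha> + 1) - 1\<close>. If \<open>x = b\<close> and
  \<open>\<alpha> > 1\<close>, the cancellation \<open>h\<^sup>1\<^sup>-\<^sup>\<alpha> h\<^sup>\<alpha> = h\<close> for \<open>h = b - x\<close> would rest on a negative
  power of zero; the last hypothesis excludes this.
\<close>

lemma kernel_bound_closed_form:
  fixes a b lam \<alpha> x :: real
  defines "c \<equiv> (1 - lam) * a + lam * b" and "d \<equiv> (1 - lam) * b + lam * a"
  assumes "1 \<le> \<alpha>" and "a < b" and "x \<le> b" and lam: "0 \<le> lam" "lam \<le> 1"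
    and nz: "x < b \<or> \<alpha> = 1"
  shows "rpow (b - x) (1 - \<alpha>) / (b - a) *
           ((weighted_primitive b \<alpha> c a + weighted_primitive b \<alpha> c x
               - 2 * weighted_primitive b \<alpha> c c)
            + (weighted_primitive b \<alpha> d x + weighted_primitive b \<alpha> d b
               - 2 * weighted_primitive b \<alpha> d d))
         = 1 / (\<alpha> * (\<alpha> + 1)) *
             ((b - a) powr \<alpha> * rpow (b - x) (1 - \<alpha>) *
                (2 * lam powr (\<alpha> + 1) + 2 * (1 - lam) powr (\<alpha> + 1) + lam * (\<alpha> + 1) - 1)
              + (b - x) * (2 * \<alpha> * ((b - x) / (b - a)) - (\<alpha> + 1)))"
proof -
  define L h R where "L = b - a" and "h = b - x" and "R = rpow h (1 - \<alpha>)"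
  have L: "L > 0" and h: "h \<ge> 0" using assms by (auto simp: L_def h_def)
  have bc: "b - c = (1 - lam) * L" "b - d = lam * L"
    by (simp_all add: c_def d_def L_def algebra_simps)
  have L1: "L powr (\<alpha> + 1) = L powr \<alpha> * L" and h1: "h powr (\<alpha> + 1) = h powr \<alpha> * h"
    using L h by (simp_all add: powr_add)
  have Rh: "R * h powr \<alpha> = h"
    using nz h by (auto simp: R_def rpow_def h_def simp flip: powr_add)
  define A where "A = 2 * lam powr (\<alpha> + 1) + 2 * (1 - lam) powr (\<alpha> + 1) + lam * (\<alpha> + 1) - 1"
  have ca: "weighted_primitive b \<alpha> c a = L powr \<alpha> * L * (lam * (\<alpha> + 1) - 1) / (\<alpha> * (\<alpha> + 1))"
    using assms(3) unfolding weighted_primitive_def bc L_def[symmetric] L1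
    by (simp add: divide_simps) (simp add: algebra_simps)
  have cx: "weighted_primitive b \<alpha> c x + weighted_primitive b \<alpha> d x
      = h powr \<alpha> * (2 * \<alpha> * h - (\<alpha> + 1) * L) / (\<alpha> * (\<alpha> + 1))"
    using assms(3) unfolding weighted_primitive_def bc h_def[symmetric] h1
    by (simp add: divide_simps) (simp add: algebra_simps)
  have db: "weighted_primitive b \<alpha> d b = 0"
    by (simp add: weighted_primitive_def)
  have nodes: "weighted_primitive b \<alpha> c c = - ((1 - lam) powr (\<alpha> + 1) * (L powr \<alpha> * L)) / (\<alpha> * (\<alpha> + 1))"
    "weighted_primitive b \<alpha> d d = - (lam powr (\<alpha> + 1) * (L powr \<alpha> * L)) / (\<alpha> * (\<alpha> + 1))"
    using weighted_primitive_at_node[OF assms(3) _ _ bc(1)]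
      weighted_primitive_at_node[OF assms(3) _ _ bc(2)] lam L by (simp_all add: L1)
  have "(weighted_primitive b \<alpha> c a + weighted_primitive b \<alpha> c x - 2 * weighted_primitive b \<alpha> c c)
      + (weighted_primitive b \<alpha> d x + weighted_primitive b \<alpha> d b - 2 * weighted_primitive b \<alpha> d d)
    = weighted_primitive b \<alpha> c a
      + (weighted_primitive b \<alpha> c x + weighted_primitive b \<alpha> d x)
      - 2 * weighted_primitive b \<alpha> c c - 2 * weighted_primitive b \<alpha> d d"
    by (simp add: db)
  also have "\<dots> = (L powr \<alpha> * L * A + h powr \<alpha> * (2 * \<alpha> * h - (\<alpha> + 1) * L)) / (\<alpha> * (\<alpha> + 1))"
    unfolding ca cx nodes A_def by (simp add: add_divide_distrib diff_divide_distrib algebra_simps)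
  finally have S: "(weighted_primitive b \<alpha> c a + weighted_primitive b \<alpha> c x - 2 * weighted_primitive b \<alpha> c c)
      + (weighted_primitive b \<alpha> d x + weighted_primitive b \<alpha> d b - 2 * weighted_primitive b \<alpha> d d)
    = (L powr \<alpha> * L * A + h powr \<alpha> * (2 * \<alpha> * h - (\<alpha> + 1) * L)) / (\<alpha> * (\<alpha> + 1))" .
  have "R / L * (L powr \<alpha> * L * A + h powr \<alpha> * (2 * \<alpha> * h - (\<alpha> + 1) * L))
      = L powr \<alpha> * R * A + (R * h powr \<alpha>) * (2 * \<alpha> * (h / L) - (\<alpha> + 1))"
    using L by (simp add: field_simps)
  then show ?thesis
    unfolding S L_def[symmetric] h_def[symmetric] R_def[symmetric] A_def[symmetric]
    by (simp only: times_divide_eq_right Rh mult_1 times_divide_eq_left)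
qed

theorem theorem4:
  fixes f :: "real \<Rightarrow> real" and a b lam \<alpha> M x :: real
  assumes "0 \<le> a" and "a < b"
    and "continuous_on {a..b} f"
    and "f differentiable_on {a<..<b}"
    and "deriv f absolutely_integrable_on {a..b}"
    and "0 \<le> lam" and "lam \<le> 1"
    and "\<forall>t\<in>{a<..<b}. \<bar>deriv f t\<bar> \<le> M"
    and "1 \<le> \<alpha>"
    and "x \<in> {a..b}" and "x < b \<or> \<alpha> = 1"
  shows "\<bar>(1 - 2 * lam) * f x
           - Gamma \<alpha> / (b - a) * rpow (b - x) (1 - \<alpha>) * RL_integral a \<alpha> f b
           + lam * rpow ((b - a) / (b - x)) (\<alpha> - 1) * f a
           + RL_integral a (\<alpha> - 1) (\<lambda>t. P3 a b lam \<alpha> x t * f t) b\<bar>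
         \<le> M / (\<alpha> * (\<alpha> + 1)) *
             ((b - a) powr \<alpha> * rpow (b - x) (1 - \<alpha>) *
                (2 * lam powr (\<alpha> + 1) + 2 * (1 - lam) powr (\<alpha> + 1) + lam * (\<alpha> + 1) - 1)
              + (b - x) * (2 * \<alpha> * ((b - x) / (b - a)) - (\<alpha> + 1)))"
proof -
  let ?c = "(1 - lam) * a + lam * b" and ?d = "(1 - lam) * b + lam * a"
  let ?R = "rpow (b - x) (1 - \<alpha>)"
  \<comment> \<open>The bound on \<open>f'\<close> is assumed inside the interval only; the value 0 extends it to the end points.\<close>
  define g where "g t = (if t \<in> {a<..<b} then deriv f t else 0)" for t
  have ax: "a \<le> x" "x \<le> b" using assms by auto
  have L: "0 < b - a" using assms by simp
  have deriv_f: "(f has_real_derivative g t) (at t)" if "t \<in> {a<..<b}" for t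
  proof -
    have "f differentiable at t within {a<..<b}"
      using assms(4) that unfolding differentiable_on_def by blast
    then have "f field_differentiable at t"
      using at_within_open[OF that open_greaterThanLessThan]
      by (auto simp: field_differentiable_def real_differentiable_def)
    then show ?thesis
      using that DERIV_deriv_iff_field_differentiable[of f t] by (simp add: g_def)
  qed
  have M: "0 \<le> M"
    using bspec[OF assms(8), of "(a + b) / 2"] assms(2) by simp
  have g_le: "\<bar>g t\<bar> \<le> M" for t
    using assms(8) M by (auto simp: g_def)
  define I where "I = rpow (b - x) (\<alpha> - 1) * (?d - ?c) * f x
          + rpow (b - b) (\<alpha> - 1) * (b - ?d) * f b - rpow (b - a) (\<alpha> - 1) * (a - ?c) * f a
          - integral {a..b} (\<lambda>t. rpow (b - t) (\<alpha> - 1) * f t)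
          + (\<alpha> - 1) * integral {a..b} (\<lambda>t. (b - t) powr (\<alpha> - 2) * (two_piece_kernel ?c ?d x t * f t))"
  have I: "((\<lambda>t. rpow (b - t) (\<alpha> - 1) * two_piece_kernel ?c ?d x t * g t) has_integral I) {a..b}"
    unfolding I_def by (rule weighted_montgomery_identity[OF assms(9) ax assms(3) deriv_f])
  have nodes: "?c \<le> b" "?d \<le> b"
    using mult_left_mono[of a b "1 - lam"] mult_left_mono[of a b lam] assms
    by (auto simp: algebra_simps)
  have R1: "?R * rpow (b - x) (\<alpha> - 1) = 1"
    using rpow_mult_self[of "b - x" "\<alpha> - 1"] ax assms(11) by auto
  have Ra: "rpow ((b - a) / (b - x)) (\<alpha> - 1) = ?R * rpow (b - a) (\<alpha> - 1)"
    using assms(11) L by (auto simp: rpow_def powr_divide powr_minus_divide powr_diff)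
  have lin: "?d - ?c = (1 - 2 * lam) * (b - a)" "b - ?d = lam * (b - a)" "a - ?c = - lam * (b - a)"
    by (simp_all add: algebra_simps)
  have regroup: "R * wx * k * fx - R / l * A + lam * (R * wa) * fa + R / l * (wb * (lam * l) * fb + B)
      = R / l * (wx * (k * l) * fx + wb * (lam * l) * fb - wa * (- lam * l) * fa - A + B)"
    if "l \<noteq> 0" for R wx k fx l A wa fa wb fb B :: real
    using that by (simp add: field_simps)
  have "(1 - 2 * lam) * f x
           - Gamma \<alpha> / (b - a) * ?R * RL_integral a \<alpha> f b
           + lam * rpow ((b - a) / (b - x)) (\<alpha> - 1) * f a
           + RL_integral a (\<alpha> - 1) (\<lambda>t. P3 a b lam \<alpha> x t * f t) b
      = (?R * rpow (b - x) (\<alpha> - 1)) * (1 - 2 * lam) * f x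
           - ?R / (b - a) * (Gamma \<alpha> * RL_integral a \<alpha> f b)
           + lam * (?R * rpow (b - a) (\<alpha> - 1)) * f a
           + RL_integral a (\<alpha> - 1) (\<lambda>t. P3 a b lam \<alpha> x t * f t) b"
    unfolding R1 Ra by simp
  also have "\<dots> = ?R / (b - a) * I"
    unfolding RL_integral_eq_integral_rpow[OF assms(9) less_imp_le[OF assms(2)] assms(3)]
      RL_integral_P3[OF assms(9,2) ax(2) assms(3)] I_def lin
    using L by (intro regroup) simp
  finally have identity: "(1 - 2 * lam) * f x
           - Gamma \<alpha> / (b - a) * ?R * RL_integral a \<alpha> f b
           + lam * rpow ((b - a) / (b - x)) (\<alpha> - 1) * f a
           + RL_integral a (\<alpha> - 1) (\<lambda>t. P3 a b lam \<alpha> x t * f t) b = ?R / (b - a) * I" .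
  have "\<bar>?R / (b - a) * I\<bar> = ?R / (b - a) * \<bar>I\<bar>"
    using L by (simp add: abs_mult rpow_nonneg)
  also have "\<dots> \<le> ?R / (b - a) * (M *
          ((weighted_primitive b \<alpha> ?c a + weighted_primitive b \<alpha> ?c x
               - 2 * weighted_primitive b \<alpha> ?c ?c)
            + (weighted_primitive b \<alpha> ?d x + weighted_primitive b \<alpha> ?d b
               - 2 * weighted_primitive b \<alpha> ?d ?d)))"
    using L by (intro mult_left_mono integral_weighted_kernel_le[OF assms(9) ax nodes M g_le I])
      (simp add: rpow_nonneg)
  also have "\<dots> = M * (?R / (b - a) *
          ((weighted_primitive b \<alpha> ?c a + weighted_primitive b \<alpha> ?c x
               - 2 * weighted_primitive b \<alpha> ?c ?c)
            + (weighted_primitive b \<alpha> ?d x + weighted_primitive b \<alpha> ?d b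
               - 2 * weighted_primitive b \<alpha> ?d ?d)))"
    by (simp only: mult.left_commute)
  also have "\<dots> = M / (\<alpha> * (\<alpha> + 1)) *
             ((b - a) powr \<alpha> * ?R *
                (2 * lam powr (\<alpha> + 1) + 2 * (1 - lam) powr (\<alpha> + 1) + lam * (\<alpha> + 1) - 1)
              + (b - x) * (2 * \<alpha> * ((b - x) / (b - a)) - (\<alpha> + 1)))"
    unfolding kernel_bound_closed_form[OF assms(9,2) ax(2) assms(6,7,11)] by simp
  finally show ?thesis unfolding identity .
qed

end
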